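(* Let $X$ be a locally convex space carrying weak topology and $T\in L(X)$. Then the following conditions are equivalent: (1) $T'$ has no non-trivial finite dimensional invariant subspaces; (2) $T$ is transitive; (3) $T$ is mixing; (4) the semigroup $\{p(T)\}_{p\in\mathcal P^*}$ is mixing, where $\mathcal P^*=\mathbb K[z]\setminus\{0\}$ is the multiplicative semigroup of non-zero polynomials with the norm $|p|=\deg p$; that is, for any non-empty open $U,V\subseteq X$ there is $r>0$ such that $p(T)(U)\cap V\neq\varnothing$ for every $p\in\mathcal P^*$ with $\deg p>r$.
   Context: Conventions: $\mathbb K$ is $\mathbb R$ or $\mathbb C$; all vector spaces are non-zero and over $\mathbb K$; all topological spaces are Hausdorff. $L(X)$ is the space of continuous linear operators on $X$, $X'$ is the space of continuous linear functionals on $X$, and $T':X'\to X'$ is given by $(T'f)(x)=f(Tx)$. A subspace is non-trivial if it is non-zero. A locally convex space $X$ carries a weak topology if its topology coincides with $\sigma(X,Y)$ (the weakest topology making all functionals in $Y$ continuous) for some linear space $Y$ of linear functionals on $X$ separating points of $X$. $T\in L(X)$ is transitive if for any non-empty open $U,V\subseteq X$ the set $\{n\in\mathbb Z_+:T^n(U)\cap V\neq\varnothing\}$ is unbounded. $T$ is mixing if for any non-empty open $U,V\subseteq X$ there is $r>0$ such that $T^n(U)\cap V\neq\varnothing$ for all integers $n>r$. *)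

theory Defs
  imports Complex_Main "HOL-Library.Function_Algebras" "HOL-Computational_Algebra.Polynomial"
begin

text \<open>The scalar field is \<open>\<real>\<close> or \<open>\<complex>\<close>, up to isometric isomorphism of fields.\<close>

class real_or_complex = real_normed_field +
  assumes real_or_complex:
    "\<exists>\<phi> :: 'a \<Rightarrow> complex.
       \<phi> 1 = 1 \<and> (\<forall>a b. \<phi> (a + b) = \<phi> a + \<phi> b) \<and> (\<forall>a b. \<phi> (a * b) = \<phi> a * \<phi> b) \<and>
       (\<forall>a. norm (\<phi> a) = norm a) \<and> (range \<phi> = \<real> \<or> range \<phi> = UNIV)"

instance real :: real_or_complex
  by standard (rule exI[of _ complex_of_real], simp add: Reals_def)

instance complex :: real_or_complex
  by standard (rule exI[of _ "\<lambda>z. z"], simp)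

locale locally_convex_space = vector_space scale
  for scale :: "'k::real_or_complex \<Rightarrow> 'v::{topological_ab_group_add, t2_space} \<Rightarrow> 'v" +
  assumes continuous_scale: "continuous_on UNIV (\<lambda>(c, x). scale c x)"
    and convex_neighbourhoods:
      "\<And>U. open U \<Longrightarrow> 0 \<in> U \<Longrightarrow>
        \<exists>C W. open W \<and> 0 \<in> W \<and> W \<subseteq> C \<and> C \<subseteq> U \<and>
          (\<forall>x\<in>C. \<forall>y\<in>C. \<forall>t. 0 \<le> t \<and> t \<le> 1 \<longrightarrow>
             scale (of_real (1 - t)) x + scale (of_real t) y \<in> C)"
    and non_zero: "\<exists>x::'v. x \<noteq> 0"

text \<open>Pointwise scalar multiplication; addition and zero on functions are the pointwise ones of
  \<open>Function_Algebras\<close>, so scalar-valued functions form the vector space below.\<close>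

definition fun_scale :: "'k::field \<Rightarrow> ('v \<Rightarrow> 'k) \<Rightarrow> 'v \<Rightarrow> 'k" where
  "fun_scale c f = (\<lambda>x. c * f x)"

lemma vector_space_fun_scale: "vector_space fun_scale"
  by unfold_locales (auto simp: fun_scale_def fun_eq_iff algebra_simps)

text \<open>The \<open>generate_topology\<close> term is \<open>\<sigma>(X, Y)\<close>; the functionals in \<open>Y\<close> are not assumed
  continuous, which follows.\<close>

definition carries_weak_topology ::
  "('k::real_or_complex \<Rightarrow> 'v::{ab_group_add, topological_space} \<Rightarrow> 'v) \<Rightarrow> bool" where
  "carries_weak_topology scale \<longleftrightarrow>
     (\<exists>Y. module.subspace fun_scale Y \<and>
          (\<forall>f\<in>Y. Vector_Spaces.linear scale (*) f) \<and>
          (\<forall>x y. x \<noteq> y \<longrightarrow> (\<exists>f\<in>Y. f x \<noteq> f y)) \<and>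
          (open :: 'v set \<Rightarrow> bool) = generate_topology {f -` G | f G. f \<in> Y \<and> open G})"

definition continuous_operators ::
  "('k::real_or_complex \<Rightarrow> 'v::{ab_group_add, topological_space} \<Rightarrow> 'v) \<Rightarrow> ('v \<Rightarrow> 'v) set" where
  "continuous_operators scale = {T. Vector_Spaces.linear scale scale T \<and> continuous_on UNIV T}"

definition dual_space ::
  "('k::real_or_complex \<Rightarrow> 'v::{ab_group_add, topological_space} \<Rightarrow> 'v) \<Rightarrow> ('v \<Rightarrow> 'k) set" where
  "dual_space scale = {f. Vector_Spaces.linear scale (*) f \<and> continuous_on UNIV f}"

definition dual_operator :: "('v \<Rightarrow> 'v) \<Rightarrow> ('v \<Rightarrow> 'k) \<Rightarrow> 'v \<Rightarrow> 'k" where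
  "dual_operator T f = (\<lambda>x. f (T x))"

definition dual_has_nontrivial_finite_dim_invariant_subspace ::
  "('k::real_or_complex \<Rightarrow> 'v::{ab_group_add, topological_space} \<Rightarrow> 'v) \<Rightarrow> ('v \<Rightarrow> 'v) \<Rightarrow> bool" where
  "dual_has_nontrivial_finite_dim_invariant_subspace scale T \<longleftrightarrow>
     (\<exists>L. L \<subseteq> dual_space scale \<and> module.subspace fun_scale L \<and> L \<noteq> {0} \<and>
          (\<exists>B. finite B \<and> module.span fun_scale B = L) \<and>
          dual_operator T ` L \<subseteq> L)"

definition transitive_operator :: "('v::topological_space \<Rightarrow> 'v) \<Rightarrow> bool" where
  "transitive_operator T \<longleftrightarrow>
     (\<forall>U V. open U \<and> U \<noteq> {} \<and> open V \<and> V \<noteq> {} \<longrightarrow>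
        \<not> bdd_above {n::nat. (T ^^ n) ` U \<inter> V \<noteq> {}})"

definition mixing_operator :: "('v::topological_space \<Rightarrow> 'v) \<Rightarrow> bool" where
  "mixing_operator T \<longleftrightarrow>
     (\<forall>U V. open U \<and> U \<noteq> {} \<and> open V \<and> V \<noteq> {} \<longrightarrow>
        (\<exists>r::real. r > 0 \<and> (\<forall>n::nat. real n > r \<longrightarrow> (T ^^ n) ` U \<inter> V \<noteq> {})))"

definition poly_operator ::
  "('k::field \<Rightarrow> 'v::ab_group_add \<Rightarrow> 'v) \<Rightarrow> 'k poly \<Rightarrow> ('v \<Rightarrow> 'v) \<Rightarrow> 'v \<Rightarrow> 'v" where
  "poly_operator scale p T = (\<lambda>x. \<Sum>i\<le>degree p. scale (coeff p i) ((T ^^ i) x))"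

definition mixing_poly_semigroup ::
  "('k::field \<Rightarrow> 'v::{ab_group_add, topological_space} \<Rightarrow> 'v) \<Rightarrow> ('v \<Rightarrow> 'v) \<Rightarrow> bool" where
  "mixing_poly_semigroup scale T \<longleftrightarrow>
     (\<forall>U V. open U \<and> U \<noteq> {} \<and> open V \<and> V \<noteq> {} \<longrightarrow>
        (\<exists>r::real. r > 0 \<and>
           (\<forall>p. p \<noteq> 0 \<and> real (degree p) > r \<longrightarrow> poly_operator scale p T ` U \<inter> V \<noteq> {})))"

end

theory Submission
  imports Defs "HOL-Computational_Algebra.Fundamental_Theorem_Algebra"
begin

text \<open>The adjoint of \<open>T\<close> makes \<open>X'\<close> a module over \<open>K[z]\<close>, and \<open>T'\<close> has a non-trivial finite
  dimensional invariant subspace iff this module has torsion. If it has torsion, some non-zero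
  continuous \<open>g : X \<rightarrow> \<complex>\<close> (complex valued also when \<open>K = \<real>\<close>) satisfies \<open>g (T x) = \<mu> g x\<close>, and then
  \<open>T\<close> cannot move \<open>{|g| < 1}\<close> into \<open>{|g| > 1}\<close> and back. If it is torsion-free, every finite
  dimensional \<open>E \<subseteq> X'\<close> satisfies \<open>E \<inter> p E = 0\<close> as soon as \<open>deg p\<close> is large, so the values of all
  \<open>f \<in> E\<close> can be prescribed at \<open>x\<close> and at \<open>p(T) x\<close> independently. In a weak topology a non-empty
  open set contains all points at which finitely many functionals take certain prescribed values,
  hence \<open>p(T)(U)\<close> meets \<open>V\<close>.\<close>

section \<open>The polynomial module of scalar functions\<close>

text \<open>This is the action of \<open>p(T')\<close> on \<open>f\<close>, that is \<open>f\<close>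
  composed with \<open>p(T)\<close> when \<open>f\<close> is linear. Using only values of
  \<open>f\<close> along orbits, it also makes sense for complex valued \<open>f\<close> on a real
  space.\<close>

definition pullback :: "('v \<Rightarrow> 'v) \<Rightarrow> 'k::comm_ring_1 poly \<Rightarrow> ('v \<Rightarrow> 'k) \<Rightarrow> 'v \<Rightarrow> 'k" where
  "pullback T p f = (\<lambda>x. \<Sum>i\<le>degree p. coeff p i * f ((T ^^ i) x))"

lemma pullback_eq_sum:
  assumes "degree p \<le> n"
  shows "pullback T p f x = (\<Sum>i\<le>n. coeff p i * f ((T ^^ i) x))"
  unfolding pullback_def using assms
  by (intro sum.mono_neutral_left) (auto simp: coeff_eq_0)

lemma pullback_0 [simp]: "pullback T 0 f = 0"
  by (simp add: pullback_def fun_eq_iff)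

lemma pullback_0_right [simp]: "pullback T p 0 = 0"
  by (simp add: pullback_def fun_eq_iff)

lemma pullback_add: "pullback T (p + q) f = pullback T p f + pullback T q f"
proof
  fix x
  let ?n = "max (degree p) (degree q)"
  show "pullback T (p + q) f x = (pullback T p f + pullback T q f) x"
    by (simp add: pullback_eq_sum[of p ?n] pullback_eq_sum[of q ?n]
        pullback_eq_sum[of "p + q" ?n] degree_add_le_max sum.distrib distrib_right)
qed

lemma pullback_add_right: "pullback T p (f + g) = pullback T p f + pullback T p g"
  by (simp add: pullback_def fun_eq_iff distrib_left sum.distrib)

lemma pullback_pCons: "pullback T (pCons a p) f x = a * f x + pullback T p f (T x)"
proof -
  have "pullback T (pCons a p) f x =
      (\<Sum>i\<le>Suc (degree p). coeff (pCons a p) i * f ((T ^^ i) x))"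
    by (rule pullback_eq_sum) (simp add: degree_pCons_le)
  also have "\<dots> = a * f x + (\<Sum>i\<le>degree p. coeff p i * f ((T ^^ i) (T x)))"
    by (simp add: sum.atMost_Suc_shift funpow_swap1 del: sum.atMost_Suc)
  finally show ?thesis by (simp add: pullback_def)
qed

lemma pullback_const: "pullback T [:a:] f x = a * f x"
  by (simp add: pullback_pCons)

lemma pullback_smult: "pullback T (smult a p) f x = a * pullback T p f x"
  by (simp add: pullback_eq_sum[of _ "degree p"] degree_smult_le sum_distrib_left mult.assoc)

lemma pullback_mult: "pullback T (p * q) f = pullback T p (pullback T q f)"
proof (induction p)
  case (pCons a p)
  then show ?case
    by (simp add: fun_eq_iff pullback_add pullback_smult pullback_pCons)
qed simp

text \<open>The scalars are the ring of polynomials, so torsion is possible; this instance makes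
  \<open>independent\<close> mean independence over \<open>K[z]\<close>.\<close>

lemma module_pullback: "module (pullback T)"
proof
  show "pullback T 1 f = f" for f :: "'b \<Rightarrow> 'a"
    by (simp add: fun_eq_iff one_pCons pullback_const)
qed (simp_all add: pullback_add pullback_add_right pullback_mult)

lemma sum_fun_apply: "sum f A x = (\<Sum>i\<in>A. f i x)"
  by (induction A rule: infinite_finite_induct) simp_all

lemma pullback_monom: "pullback T (monom c n) f x = c * f ((T ^^ n) x)"
  by (induction n arbitrary: x)
     (simp_all add: monom_0 monom_Suc pullback_pCons funpow_swap1)

section \<open>Linear algebra over the field and over its polynomial ring\<close>

text \<open>The vectors \<open>(\<phi> i x)\<close> form a subspace of \<open>K^I\<close>, and a
  subspace of a finite dimensional space is cut out by the linear relations it satisfies. The family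
  is indexed, so functionals may repeat.\<close>

lemma functional_values_exist:
  fixes scale :: "'k::field \<Rightarrow> 'v::ab_group_add \<Rightarrow> 'v"
  assumes "vector_space scale" and "finite I"
    and "\<And>i. i \<in> I \<Longrightarrow> Vector_Spaces.linear scale (*) (\<phi> i)"
    and "\<And>c. (\<forall>x. (\<Sum>i\<in>I. c i * \<phi> i x) = 0) \<Longrightarrow> (\<Sum>i\<in>I. c i * a i) = 0"
  shows "\<exists>x. \<forall>i\<in>I. \<phi> i x = a i"
  using assms(2-)
proof (induction I arbitrary: \<phi> a rule: finite_induct)
  case (insert j I)
  have lin: "Vector_Spaces.linear scale (*) (\<phi> i)" if "i \<in> insert j I" for i
    using insert.prems(1) that .
  have add: "\<phi> i (x + y) = \<phi> i x + \<phi> i y" and scl: "\<phi> i (scale c x) = c * \<phi> i x"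
    if "i \<in> insert j I" for i x y c
    using lin[OF that] by (simp_all add: Vector_Spaces.linear_iff)
  \<comment> \<open>The compatibility hypothesis with the coefficient \<open>b\<close> of the new
    functional split off.\<close>
  have rel: "(\<Sum>i\<in>I. c i * a i) + b * a j = 0"
    if "\<And>x. (\<Sum>i\<in>I. c i * \<phi> i x) + b * \<phi> j x = 0" for c b
  proof -
    have eq: "(\<Sum>i\<in>insert j I. (c(j := b)) i * g i) = (\<Sum>i\<in>I. c i * g i) + b * g j" for g
    proof -
      have "(\<Sum>i\<in>I. (c(j := b)) i * g i) = (\<Sum>i\<in>I. c i * g i)"
        using insert.hyps by (intro sum.cong) auto
      with insert.hyps show ?thesis by (simp add: add.commute)
    qed
    show ?thesis
      using insert.prems(2)[of "c(j := b)"] that unfolding eq by simp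
  qed
  show ?case
  proof (cases "\<forall>x. \<phi> j x = 0")
    case True
    with rel[of "\<lambda>_. 0" 1] have "a j = 0" by simp
    have "\<exists>x. \<forall>i\<in>I. \<phi> i x = a i"
    proof (rule insert.IH)
      fix c assume "\<forall>x. (\<Sum>i\<in>I. c i * \<phi> i x) = 0"
      with rel[of c 0] show "(\<Sum>i\<in>I. c i * a i) = 0" by simp
    qed (use lin in blast)
    with True \<open>a j = 0\<close> show ?thesis by auto
  next
    case False
    then obtain e' where "\<phi> j e' \<noteq> 0" by blast
    then obtain e where e: "\<phi> j e = 1"
      using scl[of j "inverse (\<phi> j e')" e'] by auto
    \<comment> \<open>Gaussian elimination with pivot \<open>\<phi> j\<close>\<close>
    have "\<exists>x. \<forall>i\<in>I. \<phi> i x - \<phi> i e * \<phi> j x = a i - \<phi> i e * a j"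
    proof (rule insert.IH)
      fix i assume "i \<in> I"
      then show "Vector_Spaces.linear scale (*) (\<lambda>x. \<phi> i x - \<phi> i e * \<phi> j x)"
        using lin[of i] lin[of j]
        by (auto simp: Vector_Spaces.linear_iff algebra_simps)
    next
      \<comment> \<open>A relation among the reduced functionals is a relation among the original
        ones, with the coefficient of \<open>\<phi> j\<close> read off here.\<close>
      have eq: "(\<Sum>i\<in>I. c i * (g i - \<phi> i e * b)) =
          (\<Sum>i\<in>I. c i * g i) + (- (\<Sum>i\<in>I. c i * \<phi> i e)) * b" for c g b
        by (simp add: right_diff_distrib sum_subtractf sum_distrib_right mult.assoc)
      fix c assume "\<forall>x. (\<Sum>i\<in>I. c i * (\<phi> i x - \<phi> i e * \<phi> j x)) = 0"
      then have "(\<Sum>i\<in>I. c i * \<phi> i x) + (- (\<Sum>i\<in>I. c i * \<phi> i e)) * \<phi> j x = 0" for x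
        by (simp only: flip: eq)
      from rel[OF this] show "(\<Sum>i\<in>I. c i * (a i - \<phi> i e * a j)) = 0"
        by (rule trans[OF eq])
    qed
    then obtain x where x: "\<And>i. i \<in> I \<Longrightarrow> \<phi> i x - \<phi> i e * \<phi> j x = a i - \<phi> i e * a j"
      by blast
    \<comment> \<open>The reduced functionals vanish at \<open>e\<close> because
      \<open>\<phi> j e = 1\<close>; adding a multiple of \<open>e\<close> therefore corrects
      \<open>\<phi> j\<close> without disturbing them.\<close>
    have "\<phi> i (x + scale (a j - \<phi> j x) e) = a i" if "i \<in> insert j I" for i
      using x[of i] that e by (auto simp: add scl algebra_simps)
    then show ?thesis by blast
  qed
qed simp

text \<open>Clearing denominators over a maximal \<open>K[z]\<close>-independent subset of \<open>F\<close> turns the scalar span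
  of \<open>F\<close> into tuples of polynomials of bounded degree.\<close>

lemma poly_module_degree_bound:
  fixes s :: "'k::field poly \<Rightarrow> 'm::ab_group_add \<Rightarrow> 'm"
  assumes "module s" and "finite F"
    and torsion_free: "\<And>q d. q \<noteq> 0 \<Longrightarrow> s q (\<Sum>e\<in>F. s [:d e:] e) = 0 \<Longrightarrow> (\<Sum>e\<in>F. s [:d e:] e) = 0"
  shows "\<exists>N. \<forall>p c d. degree p > N \<longrightarrow>
    (\<Sum>e\<in>F. s [:c e:] e) + s p (\<Sum>e\<in>F. s [:d e:] e) = 0 \<longrightarrow> (\<Sum>e\<in>F. s [:d e:] e) = 0"
proof -
  interpret module s by fact
  have "finite {G. G \<subseteq> F \<and> independent G}"
    using \<open>finite F\<close> by simp
  moreover have "{} \<in> {G. G \<subseteq> F \<and> independent G}"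
    by (simp add: independent_empty)
  ultimately obtain G where G: "G \<subseteq> F" "independent G"
    and G_max: "\<And>H. H \<subseteq> F \<Longrightarrow> independent H \<Longrightarrow> G \<subseteq> H \<Longrightarrow> H = G"
    by (smt (verit) empty_iff finite_has_maximal mem_Collect_eq)
  have "finite G"
    using G \<open>finite F\<close> finite_subset by blast
  \<comment> \<open>By maximality of \<open>G\<close>, every element of \<open>F\<close> has a
    non-zero polynomial multiple in the \<open>K[z]\<close>-span of \<open>G\<close>.\<close>
  have "\<exists>q b. q \<noteq> 0 \<and> s q e = (\<Sum>g\<in>G. s (b g) g)" if "e \<in> F" for e
  proof (cases "e \<in> G")
    case True
    have "s 1 e = (\<Sum>g\<in>G. s (if g = e then 1 else 0) g)"
      using True \<open>finite G\<close> by (simp add: if_distrib[of "\<lambda>c. s c _"] sum.delta cong: if_cong)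
    then show ?thesis by (intro exI conjI) (rule one_neq_zero)
  next
    case False
    have "dependent (insert e G)"
      using G_max[of "insert e G"] that G False by blast
    then obtain u where u: "\<exists>v\<in>insert e G. u v \<noteq> 0" "(\<Sum>v\<in>insert e G. s (u v) v) = 0"
      using \<open>finite G\<close> by (auto simp: dependent_finite)
    from u(2) have eq: "s (u e) e + (\<Sum>v\<in>G. s (u v) v) = 0"
      using False \<open>finite G\<close> by simp
    \<comment> \<open>Otherwise the relation would be a non-trivial one within the independent set
      \<open>G\<close>.\<close>
    have "u e \<noteq> 0"
      using eq u(1) independentD[OF G(2) \<open>finite G\<close> subset_refl, of u] by auto
    moreover have "s (u e) e = (\<Sum>g\<in>G. s (- u g) g)"
      using eq by (simp add: sum_negf eq_neg_iff_add_eq_0)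
    ultimately show ?thesis by (intro exI conjI)
  qed
  then obtain q where q: "\<And>e. e \<in> F \<Longrightarrow> q e \<noteq> 0"
    and "\<And>e. e \<in> F \<Longrightarrow> \<exists>b. s (q e) e = (\<Sum>g\<in>G. s (b g) g)"
    by metis
  then obtain b where b: "\<And>e. e \<in> F \<Longrightarrow> s (q e) e = (\<Sum>g\<in>G. s (b e g) g)"
    by metis
  \<comment> \<open>\<open>Q\<close> is a common denominator and \<open>a e g\<close> are the
    coordinates of \<open>Q e\<close>. Constant coefficients do not raise degrees, so
    \<open>N\<close> bounds the coordinates of \<open>Q\<close> times any scalar combination of
    \<open>F\<close>.\<close>
  define Q where "Q = (\<Prod>e\<in>F. q e)"
  define a where "a e g = (\<Prod>e'\<in>F - {e}. q e') * b e g" for e g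
  define N where "N = (\<Sum>e\<in>F. \<Sum>g\<in>G. degree (a e g))"
  have "Q \<noteq> 0"
    using q \<open>finite F\<close> by (simp add: Q_def)
  have a: "s Q e = (\<Sum>g\<in>G. s (a e g) g)" if "e \<in> F" for e
  proof -
    have "Q = (\<Prod>e'\<in>F - {e}. q e') * q e"
      using \<open>finite F\<close> that by (simp add: Q_def prod.remove mult.commute)
    then have "s Q e = s (\<Prod>e'\<in>F - {e}. q e') (s (q e) e)"
      by simp
    also have "\<dots> = (\<Sum>g\<in>G. s (a e g) g)"
      using that by (simp add: b a_def scale_sum_right)
    finally show ?thesis .
  qed
  have coords: "s Q (\<Sum>e\<in>F. s [:c e:] e) = (\<Sum>g\<in>G. s (\<Sum>e\<in>F. [:c e:] * a e g) g)" for c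
  proof -
    have "s Q (\<Sum>e\<in>F. s [:c e:] e) = (\<Sum>e\<in>F. s [:c e:] (s Q e))"
      by (simp add: scale_sum_right scale_left_commute del: scale_scale)
    also have "\<dots> = (\<Sum>e\<in>F. \<Sum>g\<in>G. s ([:c e:] * a e g) g)"
      by (simp add: a scale_sum_right)
    also have "\<dots> = (\<Sum>g\<in>G. \<Sum>e\<in>F. s ([:c e:] * a e g) g)"
      by (rule sum.swap)
    finally show ?thesis by (simp only: scale_sum_left)
  qed
  have deg: "degree (\<Sum>e\<in>F. [:c e:] * a e g) \<le> N" if "g \<in> G" for c g
  proof (rule degree_sum_le[OF \<open>finite F\<close>])
    fix e assume "e \<in> F"
    have "degree ([:c e:] * a e g) \<le> degree (a e g)"
      by (simp add: degree_smult_le)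
    also have "\<dots> \<le> (\<Sum>g\<in>G. degree (a e g))"
      using that \<open>finite G\<close> by (intro member_le_sum) auto
    also have "\<dots> \<le> N"
      unfolding N_def using \<open>e \<in> F\<close> \<open>finite F\<close>
      by (intro member_le_sum[of e F "\<lambda>e. \<Sum>g\<in>G. degree (a e g)"]) auto
    finally show "degree ([:c e:] * a e g) \<le> N" .
  qed
  show ?thesis
  proof (intro exI allI impI)
    fix p c d
    assume p: "degree p > N" and rel: "(\<Sum>e\<in>F. s [:c e:] e) + s p (\<Sum>e\<in>F. s [:d e:] e) = 0"
    let ?A = "\<lambda>c g. \<Sum>e\<in>F. [:c e:] * a e g"
    have "0 = s Q ((\<Sum>e\<in>F. s [:c e:] e) + s p (\<Sum>e\<in>F. s [:d e:] e))"
      using rel by simp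
    also have "\<dots> = s Q (\<Sum>e\<in>F. s [:c e:] e) + s p (s Q (\<Sum>e\<in>F. s [:d e:] e))"
      by (simp add: scale_right_distrib scale_left_commute del: scale_scale)
    also have "\<dots> = (\<Sum>g\<in>G. s (?A c g + p * ?A d g) g)"
      unfolding coords by (simp add: scale_sum_right scale_left_distrib sum.distrib)
    finally have rel': "?A c g + p * ?A d g = 0" if "g \<in> G" for g
      using independentD[OF G(2) \<open>finite G\<close> subset_refl, of "\<lambda>g. ?A c g + p * ?A d g"] that
      by simp
    \<comment> \<open>By \<open>rel'\<close> this product is the negative of \<open>?A c g\<close>,
      whose degree is bounded independently of \<open>p\<close>. A non-zero \<open>?A d g\<close>
      would force degree at least \<open>degree p > N\<close>.\<close>
    have le: "degree (p * ?A d g) \<le> N" if "g \<in> G" for g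
      using deg[OF that, of c] unfolding add_eq_0_iff[THEN iffD1, OF rel'[OF that]] degree_minus .
    have "?A d g = 0" if "g \<in> G" for g
    proof (rule ccontr)
      assume "?A d g \<noteq> 0"
      then have "degree p \<le> degree (p * ?A d g)"
        by (rule degree_mult_right_le)
      with le[OF that] p show False by simp
    qed
    then have "s Q (\<Sum>e\<in>F. s [:d e:] e) = 0"
      by (simp add: coords)
    then show "(\<Sum>e\<in>F. s [:d e:] e) = 0"
      using torsion_free \<open>Q \<noteq> 0\<close> by blast
  qed
qed

section \<open>Weak topologies\<close>

lemma generate_topology_functionals_neighbourhood:
  assumes "generate_topology {f -` G | f G. f \<in> Y \<and> open G} U" and "x0 \<in> U"
  shows "\<exists>F. finite F \<and> F \<subseteq> Y \<and> (\<forall>x. (\<forall>f\<in>F. f x = f x0) \<longrightarrow> x \<in> U)"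
  using assms
proof induction
  case UNIV
  then show ?case by (intro exI[of _ "{}"]) simp
next
  case (Int a b)
  then obtain F G where "finite F" "F \<subseteq> Y" "\<forall>x. (\<forall>f\<in>F. f x = f x0) \<longrightarrow> x \<in> a"
    "finite G" "G \<subseteq> Y" "\<forall>x. (\<forall>f\<in>G. f x = f x0) \<longrightarrow> x \<in> b"
    by auto
  then show ?case by (intro exI[of _ "F \<union> G"]) auto
next
  case (UN K)
  then show ?case by (meson Union_iff)
next
  case (Basis s)
  then obtain f G where "f \<in> Y" "s = f -` G" by auto
  with Basis.prems show ?case by (intro exI[of _ "{f}"]) auto
qed

lemma generate_topology_functionals_continuous:
  assumes "(open :: 'v::topological_space set \<Rightarrow> bool) = generate_topology {f -` G | f G. f \<in> Y \<and> open G}"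
    and "f \<in> Y"
  shows "continuous_on UNIV f"
  unfolding continuous_on_open_vimage[OF open_UNIV] assms(1)
  using assms(2) by (auto intro: generate_topology.Basis)

section \<open>The continuous dual as a submodule\<close>

lemma dual_spaceD:
  assumes "f \<in> dual_space scale"
  shows "f (x + y) = f x + f y" "f (scale c x) = c * f x" "f 0 = 0" "continuous_on UNIV f"
proof -
  show add: "f (x + y) = f x + f y" for x y
    using assms by (simp add: dual_space_def Vector_Spaces.linear_iff)
  from add[of 0 0] show "f 0 = 0" by simp
qed (use assms in \<open>simp_all add: dual_space_def Vector_Spaces.linear_iff\<close>)

lemma dual_space_sum:
  assumes "f \<in> dual_space scale"
  shows "f (sum g A) = (\<Sum>i\<in>A. f (g i))"
  by (induction A rule: infinite_finite_induct) (simp_all add: dual_spaceD[OF assms])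

lemma continuous_on_funpow:
  fixes T :: "'v::topological_space \<Rightarrow> 'v"
  shows "continuous_on UNIV T \<Longrightarrow> continuous_on UNIV (T ^^ n)"
proof (induction n)
  case (Suc n)
  then show ?case
    using continuous_on_compose2[of UNIV T UNIV "T ^^ n"] by (simp add: o_def)
qed (simp add: id_def)

lemma funpow_linear:
  assumes "T \<in> continuous_operators scale"
  shows "(T ^^ n) (x + y) = (T ^^ n) x + (T ^^ n) y" "(T ^^ n) (scale c x) = scale c ((T ^^ n) x)"
  using assms by (induction n) (auto simp: continuous_operators_def Vector_Spaces.linear_iff)

lemma continuous_on_pullback:
  fixes f :: "'v::topological_space \<Rightarrow> 'k::real_normed_field"
  assumes "continuous_on UNIV f" and "continuous_on UNIV T"
  shows "continuous_on UNIV (pullback T p f)"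
  unfolding pullback_def
  by (intro continuous_intros continuous_on_compose2[OF assms(1) continuous_on_funpow[OF assms(2)]]) simp

lemma pullback_dual_space:
  assumes "T \<in> continuous_operators scale" and "f \<in> dual_space scale"
  shows "pullback T p f \<in> dual_space scale"
proof -
  have "continuous_on UNIV (pullback T p f)"
    using assms by (intro continuous_on_pullback) (auto simp: continuous_operators_def dual_space_def)
  then show ?thesis
    using assms(2) unfolding dual_space_def
    by (auto simp: Vector_Spaces.linear_iff pullback_def funpow_linear[OF assms(1)]
        distrib_left sum.distrib sum_distrib_left mult.left_commute)
qed

text \<open>The adjoint identity: it turns conditions on \<open>p(T) x\<close> into conditions on
  \<open>x\<close> itself.\<close>

lemma dual_space_poly_operator:
  assumes "f \<in> dual_space scale"
  shows "f (poly_operator scale p T x) = pullback T p f x"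
  by (simp add: poly_operator_def pullback_def dual_space_sum[OF assms] dual_spaceD[OF assms])

lemma dual_space_combination:
  assumes "vector_space scale" and "F \<subseteq> dual_space scale"
  shows "(\<lambda>x. \<Sum>f\<in>F. c f * f x) \<in> dual_space scale"
proof -
  have "vector_space ((*) :: 'a \<Rightarrow> 'a \<Rightarrow> 'a)"
    by unfold_locales (simp_all add: algebra_simps)
  moreover have "continuous_on UNIV (\<lambda>x. \<Sum>f\<in>F. c f * f x)"
    using assms(2) by (intro continuous_intros) (auto simp: dual_space_def)
  moreover have "(\<Sum>f\<in>F. c f * f (x + y)) = (\<Sum>f\<in>F. c f * f x) + (\<Sum>f\<in>F. c f * f y)" for x y
    unfolding sum.distrib[symmetric]
  proof (intro sum.cong refl)
    fix f assume "f \<in> F"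
    with assms(2) show "c f * f (x + y) = c f * f x + c f * f y"
      using dual_spaceD(1)[of f scale x y] by (auto simp: distrib_left)
  qed
  moreover have "(\<Sum>f\<in>F. c f * f (scale a x)) = a * (\<Sum>f\<in>F. c f * f x)" for a x
    unfolding sum_distrib_left
  proof (intro sum.cong refl)
    fix f assume "f \<in> F"
    with assms(2) show "c f * f (scale a x) = a * (c f * f x)"
      using dual_spaceD(2)[of f scale a x] by (auto simp: mult.left_commute)
  qed
  ultimately show ?thesis
    using assms(1) by (simp add: dual_space_def Vector_Spaces.linear_iff)
qed

section \<open>Torsion and finite dimensional invariant subspaces\<close>

text \<open>The cyclic submodule \<open>K[z] f\<close> works: \<open>T'\<close> acts on it as
  multiplication by \<open>z\<close>, and it is finite dimensional because only remainders modulo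
  \<open>p\<close> matter.\<close>

lemma torsion_imp_invariant_subspace:
  assumes T: "T \<in> continuous_operators scale" and f: "f \<in> dual_space scale" "f \<noteq> 0"
    and p: "p \<noteq> 0" "pullback T p f = 0"
  shows "dual_has_nontrivial_finite_dim_invariant_subspace scale T"
proof -
  interpret fun_vs: vector_space fun_scale by (rule vector_space_fun_scale)
  interpret pb: module "pullback T" by (rule module_pullback)
  define L where "L = range (\<lambda>q. pullback T q f)"
  have fs: "fun_scale c g = pullback T [:c:] g" for c g
    by (simp add: fun_eq_iff fun_scale_def pullback_const)
  have L: "fun_vs.subspace L"
  proof (rule fun_vs.subspaceI)
    show "0 \<in> L"
      unfolding L_def by (rule range_eqI[of _ _ 0]) simp
    show "g + h \<in> L" if "g \<in> L" "h \<in> L" for g h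
      using that unfolding L_def by (auto simp flip: pb.scale_left_distrib)
    show "fun_scale c g \<in> L" if "g \<in> L" for c g
      using that unfolding L_def fs by (auto simp only: pb.scale_scale)
  qed
  have "f \<in> L"
    unfolding L_def by (rule range_eqI[of _ _ 1]) simp
  define B where "B = (\<lambda>i. pullback T (monom 1 i) f) ` {..degree p}"
  have "fun_vs.span B = L"
  proof
    show "fun_vs.span B \<subseteq> L"
      using L by (intro fun_vs.span_minimal) (auto simp: B_def L_def)
    show "L \<subseteq> fun_vs.span B"
    proof
      fix g assume "g \<in> L"
      then obtain q where q: "g = pullback T q f" by (auto simp: L_def)
      let ?r = "q mod p"
      \<comment> \<open>Division with remainder; the multiple of \<open>p\<close> annihilates
        \<open>f\<close>.\<close>
      have "g = pullback T (q div p * p + ?r) f"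
        by (simp only: q div_mult_mod_eq)
      also have "\<dots> = pullback T ?r f"
        by (simp only: pullback_add pullback_mult p(2) pullback_0_right add_0)
      also have "\<dots> = (\<Sum>i\<le>degree p. fun_scale (coeff ?r i) (pullback T (monom 1 i) f))"
      proof
        fix x
        have "degree ?r \<le> degree p"
          using degree_mod_less[OF p(1), of q] by auto
        then show "pullback T ?r f x =
            (\<Sum>i\<le>degree p. fun_scale (coeff ?r i) (pullback T (monom 1 i) f)) x"
          by (simp add: pullback_eq_sum[of ?r "degree p"] sum_fun_apply fun_scale_def pullback_monom)
      qed
      also have "\<dots> \<in> fun_vs.span B"
        by (intro fun_vs.span_sum fun_vs.span_scale fun_vs.span_base) (simp add: B_def)
      finally show "g \<in> fun_vs.span B" .
    qed
  qed
  moreover have "dual_operator T g \<in> L" if "g \<in> L" for g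
  proof -
    have "dual_operator T g = pullback T [:0, 1:] g"
      by (simp add: fun_eq_iff dual_operator_def pullback_pCons)
    with that show ?thesis
      unfolding L_def by (auto simp only: pb.scale_scale)
  qed
  moreover have "L \<subseteq> dual_space scale"
    unfolding L_def using pullback_dual_space[OF T f(1)] by blast
  moreover have "finite B"
    by (simp add: B_def)
  ultimately show ?thesis
    unfolding dual_has_nontrivial_finite_dim_invariant_subspace_def
    using L \<open>f \<in> L\<close> f(2) by blast
qed

text \<open>The iterates of \<open>T'\<close> on a non-zero \<open>f\<close> in \<open>L\<close>
  stay in a space spanned by \<open>card B\<close> vectors, so the first \<open>card B + 1\<close>
  of them satisfy a linear relation, whose coefficients form \<open>p\<close>.\<close>

lemma invariant_subspace_imp_torsion:
  fixes scale :: "'k::real_or_complex \<Rightarrow> 'v::{ab_group_add, topological_space} \<Rightarrow> 'v"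
  assumes "dual_has_nontrivial_finite_dim_invariant_subspace scale T"
  obtains f p where "f \<in> dual_space scale" "f \<noteq> 0" "p \<noteq> 0" "pullback T p f = 0"
proof -
  interpret fun_vs: vector_space fun_scale by (rule vector_space_fun_scale)
  interpret pb: module "pullback T" by (rule module_pullback)
  obtain L B where L: "L \<subseteq> dual_space scale" "fun_vs.subspace L" "L \<noteq> {0}"
    and B: "finite B" "fun_vs.span B = L" and inv: "dual_operator T ` L \<subseteq> L"
    using assms unfolding dual_has_nontrivial_finite_dim_invariant_subspace_def by blast
  obtain f where f: "f \<in> L" "f \<noteq> 0"
    using L fun_vs.subspace_0 by blast
  define g where "g i = (\<lambda>x. f ((T ^^ i) x))" for i
  have "g i \<in> L" for i
  proof (induction i)
    case (Suc i)
    have "g (Suc i) = dual_operator T (g i)"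
      by (simp add: g_def dual_operator_def fun_eq_iff funpow_swap1)
    with Suc inv show ?case by auto
  qed (simp add: g_def f)
  have "\<exists>p. p \<noteq> 0 \<and> pullback T p f = 0"
  \<comment> \<open>Dependence is a property of sets, which do not see repetitions; two equal
    iterates instead give a difference of monomials annihilating \<open>f\<close>.\<close>
  proof (cases "inj_on g {..card B}")
    case True
    have "fun_vs.dependent (g ` {..card B})"
    proof (rule ccontr)
      assume "fun_vs.independent (g ` {..card B})"
      then have "card (g ` {..card B}) \<le> card B"
        using fun_vs.independent_span_bound[OF B(1), of "g ` {..card B}"] B(2) \<open>\<And>i. g i \<in> L\<close> by blast
      then show False by (simp add: card_image True)
    qed
    then obtain u where u: "\<exists>i\<le>card B. u (g i) \<noteq> 0" "(\<Sum>v\<in>g ` {..card B}. fun_scale (u v) v) = 0"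
      by (auto simp: fun_vs.dependent_finite)
    define p where "p = (\<Sum>i\<le>card B. monom (u (g i)) i)"
    have "coeff p i = u (g i)" if "i \<le> card B" for i
      using that by (simp add: p_def coeff_sum)
    then have "p \<noteq> 0" using u(1) by force
    moreover have "pullback T p f = (\<Sum>i\<le>card B. fun_scale (u (g i)) (g i))"
      by (simp add: p_def pb.scale_sum_left fun_eq_iff sum_fun_apply pullback_monom fun_scale_def g_def)
    moreover have "\<dots> = 0"
      using u(2) by (simp add: sum.reindex True o_def)
    ultimately show ?thesis by auto
  next
    case False
    then obtain i j where ij: "i \<noteq> j" "g i = g j" by (auto simp: inj_on_def)
    have "pullback T (monom 1 i - monom 1 j) f = 0"
      using ij(2) by (simp add: pb.scale_left_diff_distrib fun_eq_iff pullback_monom g_def)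
    moreover have "coeff (monom (1::'k) i - monom 1 j) i \<noteq> 0"
      using ij(1) by simp
    ultimately show ?thesis by (metis coeff_0)
  qed
  with f L(1) that show ?thesis by blast
qed

section \<open>Torsion excludes transitivity\<close>

text \<open>Split off a root: \<open>P = (z - \<mu>) Q\<close>. Either \<open>Q\<close> does not
  annihilate \<open>f\<close>, and its action on \<open>f\<close> is the eigenfunctional, or
  \<open>Q\<close> is an annihilator of smaller degree. A non-zero constant cannot annihilate
  \<open>f\<close>.\<close>

lemma torsion_imp_eigenfunctional:
  fixes f :: "'v \<Rightarrow> complex"
  assumes "P \<noteq> 0" and "pullback T P f = 0" and "f \<noteq> 0"
  shows "\<exists>Q \<mu>. pullback T Q f \<noteq> 0 \<and> (\<forall>x. pullback T Q f (T x) = \<mu> * pullback T Q f x)"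
  using assms
proof (induction "degree P" arbitrary: P)
  case 0
  then obtain c where "P = [:c:]" by (metis degree_0_id)
  with 0 show ?case by (auto simp: fun_eq_iff pullback_const)
next
  case (Suc n)
  then have "\<not> constant (poly P)"
    by (simp add: constant_degree)
  then obtain \<mu> where "poly P \<mu> = 0"
    using fundamental_theorem_of_algebra by blast
  then obtain Q where Q: "P = [:- \<mu>, 1:] * Q"
    by (auto simp: poly_eq_0_iff_dvd)
  then have "Q \<noteq> 0" using Suc.prems by auto
  then have "degree P = Suc (degree Q)" unfolding Q by (subst degree_mult_eq) auto
  have "pullback T [:- \<mu>, 1:] (pullback T Q f) = 0"
    using Suc.prems(2) unfolding Q pullback_mult .
  then have "\<forall>x. pullback T Q f (T x) = \<mu> * pullback T Q f x"
    by (simp add: fun_eq_iff pullback_pCons)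
  then show ?case
    using Suc.hyps(1)[of Q] Suc.hyps(2) Suc.prems \<open>degree P = _\<close> \<open>Q \<noteq> 0\<close> by auto
qed

text \<open>Along an orbit \<open>norm (g x)\<close> is multiplied by powers of
  \<open>norm \<mu>\<close>, hence is monotone: no orbit passes from \<open>U\<close> to
  \<open>V\<close> if \<open>norm \<mu> \<le> 1\<close>, and none from \<open>V\<close> to
  \<open>U\<close> otherwise.\<close>

lemma eigenfunctional_imp_not_transitive:
  fixes g :: "'v::topological_space \<Rightarrow> complex"
  assumes "continuous_on UNIV g" and eig: "\<And>x. g (T x) = \<mu> * g x"
    and "g x0 = 0" and "norm (g x1) > 1"
  shows "\<not> transitive_operator T"
proof -
  define U V where "U = {x. norm (g x) < 1}" and "V = {x. norm (g x) > 1}"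
  have "open U" "open V"
    unfolding U_def V_def by (intro open_Collect_less continuous_intros assms)+
  have "x0 \<in> U" "x1 \<in> V"
    using assms by (simp_all add: U_def V_def)
  have iter: "norm (g ((T ^^ n) x)) = norm \<mu> ^ n * norm (g x)" for n x
    by (induction n) (simp_all add: eig norm_mult)
  show ?thesis
  proof (cases "norm \<mu> \<le> 1")
    case True
    have "(T ^^ n) ` U \<inter> V = {}" for n
    proof -
      have "norm (g ((T ^^ n) x)) \<le> norm (g x)" for x
        unfolding iter using True by (simp add: mult_left_le_one_le power_le_one)
      then show ?thesis using order_le_less_trans by (fastforce simp: U_def V_def)
    qed
    then have "bdd_above {n. (T ^^ n) ` U \<inter> V \<noteq> {}}" by simp
    with \<open>open U\<close> \<open>open V\<close> \<open>x0 \<in> U\<close> \<open>x1 \<in> V\<close> show ?thesis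
      unfolding transitive_operator_def by blast
  next
    case False
    have "(T ^^ n) ` V \<inter> U = {}" for n
    proof -
      have "norm (g ((T ^^ n) x)) \<ge> norm (g x)" for x
        unfolding iter using False by (simp add: mult_le_cancel_right1 one_le_power)
      then show ?thesis using order_le_less_trans by (fastforce simp: U_def V_def)
    qed
    then have "bdd_above {n. (T ^^ n) ` V \<inter> U \<noteq> {}}" by simp
    with \<open>open U\<close> \<open>open V\<close> \<open>x0 \<in> U\<close> \<open>x1 \<in> V\<close> show ?thesis
      unfolding transitive_operator_def by blast
  qed
qed

text \<open>A real annihilating polynomial may lack real roots, so \<open>f\<close> and
  \<open>p\<close> are carried to the complex numbers along the isometric embedding
  \<open>\<phi>\<close> before an eigenfunctional is extracted.\<close>

lemma torsion_imp_not_transitive: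
  fixes scale :: "'k::real_or_complex \<Rightarrow> 'v::{topological_ab_group_add, t2_space} \<Rightarrow> 'v"
  assumes T: "T \<in> continuous_operators scale" and f: "f \<in> dual_space scale" "f \<noteq> 0"
    and p: "p \<noteq> 0" "pullback T p f = 0"
  shows "\<not> transitive_operator T"
proof -
  obtain \<phi> :: "'k \<Rightarrow> complex" where
    \<phi>_add: "\<And>a b. \<phi> (a + b) = \<phi> a + \<phi> b" and \<phi>_mult: "\<And>a b. \<phi> (a * b) = \<phi> a * \<phi> b"
    and \<phi>_norm: "\<And>a. norm (\<phi> a) = norm a"
    using real_or_complex by blast
  have \<phi>_0 [simp]: "\<phi> a = 0 \<longleftrightarrow> a = 0" for a
    using \<phi>_norm[of a] by (metis norm_eq_zero)
  have \<phi>_sum: "\<phi> (sum h A) = (\<Sum>i\<in>A. \<phi> (h i))" for h :: "nat \<Rightarrow> 'k" and A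
    by (induction A rule: infinite_finite_induct) (simp_all add: \<phi>_add)
  have \<phi>_diff: "\<phi> (a - b) = \<phi> a - \<phi> b" for a b
    using \<phi>_add[of "a - b" b] by simp
  have \<phi>_cont: "continuous_on UNIV \<phi>"
    unfolding continuous_on_def tendsto_iff
    by (auto simp: dist_norm \<phi>_norm eventually_at simp flip: \<phi>_diff)
  define P where "P = map_poly \<phi> p"
  have "degree P = degree p"
    unfolding P_def by (rule degree_map_poly) simp
  have coeff_P: "coeff P i = \<phi> (coeff p i)" for i
    by (simp add: P_def coeff_map_poly)
  have "P \<noteq> 0"
    using p(1) by (simp add: P_def map_poly_eq_0_iff)
  moreover have "pullback T P (\<phi> \<circ> f) = 0"
  proof
    fix x
    have "pullback T P (\<phi> \<circ> f) x = \<phi> (pullback T p f x)"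
      by (simp add: pullback_def \<open>degree P = _\<close> \<phi>_sum \<phi>_mult coeff_P)
    then show "pullback T P (\<phi> \<circ> f) x = 0 x"
      by (simp add: p(2))
  qed
  moreover have "\<phi> \<circ> f \<noteq> 0"
    using f(2) by (auto simp: fun_eq_iff)
  ultimately obtain Q \<mu> where Q: "pullback T Q (\<phi> \<circ> f) \<noteq> 0"
    and eig: "\<And>x. pullback T Q (\<phi> \<circ> f) (T x) = \<mu> * pullback T Q (\<phi> \<circ> f) x"
    using torsion_imp_eigenfunctional by blast
  define g where "g = pullback T Q (\<phi> \<circ> f)"
  \<comment> \<open>Homogeneity through \<open>\<phi>\<close> suffices for rescaling a point into
    \<open>{norm g > 1}\<close>.\<close>
  have g_scale: "g (scale c x) = \<phi> c * g x" for c x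
    by (simp add: g_def pullback_def funpow_linear[OF T] dual_spaceD[OF f(1)] \<phi>_mult
        sum_distrib_left mult.left_commute)
  obtain x where x: "g x \<noteq> 0"
    using Q by (auto simp: g_def fun_eq_iff)
  \<comment> \<open>Chosen so that \<open>norm (g (scale c x))\<close> equals 2.\<close>
  define c :: 'k where "c = of_real (2 / norm (g x))"
  have "norm (g (scale c x)) > 1"
    using x by (simp add: g_scale norm_mult \<phi>_norm c_def norm_divide)
  moreover have "g (scale 0 x) = 0"
    by (simp add: g_scale)
  moreover have "continuous_on UNIV g"
    unfolding g_def using T dual_spaceD(4)[OF f(1)] \<phi>_cont
    by (intro continuous_on_pullback)
      (auto simp: continuous_operators_def o_def intro: continuous_on_compose2)
  ultimately show ?thesis
    using eigenfunctional_imp_not_transitive[of g T \<mu>] eig unfolding g_def by blast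
qed

section \<open>Torsion-freeness gives mixing\<close>

lemma torsion_free_imp_mixing_poly_semigroup:
  fixes scale :: "'k::real_or_complex \<Rightarrow> 'v::{topological_ab_group_add, t2_space} \<Rightarrow> 'v"
  assumes vs: "vector_space scale" and weak: "carries_weak_topology scale"
    and T: "T \<in> continuous_operators scale"
    and torsion_free: "\<And>f p. f \<in> dual_space scale \<Longrightarrow> p \<noteq> 0 \<Longrightarrow> pullback T p f = 0 \<Longrightarrow> f = 0"
  shows "mixing_poly_semigroup scale T"
  unfolding mixing_poly_semigroup_def
proof (intro allI impI, elim conjE)
  fix U V :: "'v set"
  assume UV: "open U" "U \<noteq> {}" "open V" "V \<noteq> {}"
  interpret pb: module "pullback T" by (rule module_pullback)
  obtain Y where Y_lin: "\<And>f. f \<in> Y \<Longrightarrow> Vector_Spaces.linear scale (*) f"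
    and Y_top: "(open :: 'v set \<Rightarrow> bool) = generate_topology {f -` G | f G. f \<in> Y \<and> open G}"
    using weak unfolding carries_weak_topology_def by blast
  have Y: "Y \<subseteq> dual_space scale"
    unfolding dual_space_def
    using Y_lin generate_topology_functionals_continuous[OF Y_top] by blast
  obtain x0 y0 where "x0 \<in> U" "y0 \<in> V" using UV by blast
  obtain F1 where F1: "finite F1" "F1 \<subseteq> Y" "\<And>x. (\<forall>f\<in>F1. f x = f x0) \<Longrightarrow> x \<in> U"
    using generate_topology_functionals_neighbourhood[of Y U x0] UV(1) \<open>x0 \<in> U\<close>
    unfolding Y_top by blast
  obtain F2 where F2: "finite F2" "F2 \<subseteq> Y" "\<And>x. (\<forall>f\<in>F2. f x = f y0) \<Longrightarrow> x \<in> V"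
    using generate_topology_functionals_neighbourhood[of Y V y0] UV(3) \<open>y0 \<in> V\<close>
    unfolding Y_top by blast
  define F where "F = F1 \<union> F2"
  have F: "finite F" "F \<subseteq> dual_space scale"
    using F1 F2 Y by (auto simp: F_def)
  \<comment> \<open>Scalars are written as constant polynomials to fit
    \<open>poly_module_degree_bound\<close>.\<close>
  define comb where "comb c = (\<Sum>f\<in>F. pullback T [:c f:] f)" for c
  have comb: "comb c = (\<lambda>x. \<Sum>f\<in>F. c f * f x)" for c
    by (simp add: comb_def fun_eq_iff sum_fun_apply pullback_const)
  have comb_dual: "comb c \<in> dual_space scale" for c
    unfolding comb by (rule dual_space_combination[OF vs F(2)])
  \<comment> \<open>The module of all functions may have torsion, but each \<open>comb c\<close>
    lies in \<open>dual_space scale\<close>, where torsion is excluded.\<close>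
  obtain N where N: "\<And>p c d. degree p > N \<Longrightarrow> comb c + pullback T p (comb d) = 0 \<Longrightarrow> comb d = 0"
    using poly_module_degree_bound[OF module_pullback F(1), of T] torsion_free[OF comb_dual]
    unfolding comb_def by blast
  have "poly_operator scale p T ` U \<inter> V \<noteq> {}" if "degree p > N" for p
  proof -
    let ?I = "F \<times> (UNIV :: bool set)"
    \<comment> \<open>The index \<open>False\<close> prescribes values at \<open>x\<close>, matching
      \<open>x0\<close>, and \<open>True\<close> prescribes values at \<open>p(T) x\<close>,
      matching \<open>y0\<close>.\<close>
    define \<psi> where "\<psi> = (\<lambda>(f, b). if b then pullback T p f else f)"
    define a where "a = (\<lambda>(f, b). if b then f y0 else f x0 :: 'k)"
    have split: "(\<Sum>i\<in>?I. h i) = (\<Sum>f\<in>F. h (f, False)) + (\<Sum>f\<in>F. h (f, True))"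
      for h :: "('v \<Rightarrow> 'k) \<times> bool \<Rightarrow> 'k"
      by (simp add: sum.cartesian_product' UNIV_bool sum.distrib)
    have "\<exists>x. \<forall>i\<in>?I. \<psi> i x = a i"
    proof (rule functional_values_exist[OF vs])
      show "Vector_Spaces.linear scale (*) (\<psi> i)" if "i \<in> ?I" for i
        using that F(2) pullback_dual_space[OF T] by (auto simp: \<psi>_def dual_space_def)
      fix c assume c: "\<forall>x. (\<Sum>i\<in>?I. c i * \<psi> i x) = 0"
      let ?c = "\<lambda>f. c (f, False)" and ?d = "\<lambda>f. c (f, True)"
      have "pullback T p (comb ?d) x = (\<Sum>f\<in>F. ?d f * pullback T p f x)" for x
        by (simp add: comb_def pb.scale_sum_right mult.commute[of p] sum_fun_apply
            pullback_smult)
      then have rel: "comb ?c + pullback T p (comb ?d) = 0"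
        using c by (simp add: fun_eq_iff split \<psi>_def comb)
      \<comment> \<open>The large degree of \<open>p\<close> decouples the relation into one for
        each half; evaluating these at \<open>x0\<close> and \<open>y0\<close> gives compatibility
        of the prescribed values.\<close>
      have "comb ?d = 0"
        using N[OF that rel] .
      moreover from this have "comb ?c = 0"
        using rel by simp
      ultimately show "(\<Sum>i\<in>?I. c i * a i) = 0"
        by (simp add: split a_def comb fun_eq_iff)
    qed (simp add: F)
    then obtain x where x: "\<And>f. f \<in> F \<Longrightarrow> f x = f x0" "\<And>f. f \<in> F \<Longrightarrow> pullback T p f x = f y0"
      by (auto simp: \<psi>_def a_def all_bool_eq split: if_splits)
    have "x \<in> U"
      using x(1) F1(3) by (simp add: F_def)
    moreover have "poly_operator scale p T x \<in> V"
      using x(2) F2(3) F(2) by (simp add: F_def dual_space_poly_operator subset_iff)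
    ultimately show ?thesis by blast
  qed
  then show "\<exists>r::real. r > 0 \<and> (\<forall>p. p \<noteq> 0 \<and> real (degree p) > r \<longrightarrow>
      poly_operator scale p T ` U \<inter> V \<noteq> {})"
    \<comment> \<open>The successor keeps \<open>r\<close> positive when \<open>N\<close> is
      0.\<close>
    by (intro exI[of _ "real (Suc N)"]) auto
qed

section \<open>The remaining implications\<close>

text \<open>Powers of \<open>T\<close> are the operators of the monomials \<open>monom 1 n\<close>,
  of degree exactly \<open>n\<close>.\<close>

lemma mixing_poly_semigroup_imp_mixing:
  assumes "module scale" and "mixing_poly_semigroup scale T"
  shows "mixing_operator T"
proof -
  interpret module scale by fact
  have "poly_operator scale (monom 1 n) T = T ^^ n" for n
    by (simp add: poly_operator_def fun_eq_iff degree_monom_eq if_distrib[of "\<lambda>c. scale c _"] cong: if_cong)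
  then show ?thesis
    using assms(2) unfolding mixing_poly_semigroup_def mixing_operator_def
    by (metis degree_monom_eq monom_eq_0_iff one_neq_zero)
qed

lemma mixing_imp_transitive:
  fixes T :: "'a::topological_space \<Rightarrow> 'a"
  assumes "mixing_operator T"
  shows "transitive_operator T"
  unfolding transitive_operator_def
proof (intro allI impI notI)
  fix U V :: "'a set"
  assume "open U \<and> U \<noteq> {} \<and> open V \<and> V \<noteq> {}"
  then obtain r where r: "\<And>n. real n > r \<Longrightarrow> (T ^^ n) ` U \<inter> V \<noteq> {}"
    using assms unfolding mixing_operator_def by blast
  assume "bdd_above {n. (T ^^ n) ` U \<inter> V \<noteq> {}}"
  then obtain M where M: "\<And>n. (T ^^ n) ` U \<inter> V \<noteq> {} \<Longrightarrow> n \<le> M"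
    by (auto simp: bdd_above_def)
  obtain n where "real n > max r (real M)"
    using reals_Archimedean2 by blast
  with r[of n] M[of n] show False by simp
qed

theorem theorem1p8:
  fixes scale :: "'k::real_or_complex \<Rightarrow> 'v::{topological_ab_group_add, t2_space} \<Rightarrow> 'v"
    and T :: "'v \<Rightarrow> 'v"
  assumes "locally_convex_space scale"
    and "carries_weak_topology scale"
    and "T \<in> continuous_operators scale"
  shows "(\<not> dual_has_nontrivial_finite_dim_invariant_subspace scale T \<longleftrightarrow> transitive_operator T) \<and>
         (transitive_operator T \<longleftrightarrow> mixing_operator T) \<and>
         (mixing_operator T \<longleftrightarrow> mixing_poly_semigroup scale T)"
proof -
  interpret locally_convex_space scale by fact
  \<comment> \<open>The cycle runs from (1) to (4), then (3), (2) and back to (1); torsion in the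
    dual links both ends.\<close>
  have "mixing_poly_semigroup scale T"
    if "\<not> dual_has_nontrivial_finite_dim_invariant_subspace scale T"
    using torsion_free_imp_mixing_poly_semigroup[OF vector_space_axioms assms(2,3)]
      torsion_imp_invariant_subspace[OF assms(3)] that by blast
  moreover have "\<not> dual_has_nontrivial_finite_dim_invariant_subspace scale T"
    if "transitive_operator T"
    using invariant_subspace_imp_torsion torsion_imp_not_transitive[OF assms(3)] that by metis
  ultimately show ?thesis
    using mixing_poly_semigroup_imp_mixing[OF module_axioms] mixing_imp_transitive by blast
qed

end
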